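(* Let $X$ be a Tychonoff space. Any maximal clique in $\Gamma(C_{+}(X))$ is of the form $M\cap C_{+}(X)$, where $M$ is a maximal clique in $\Gamma(C(X))$.
   Context: For a Tychonoff space $X$, $C(X)$ is the ring of real-valued continuous functions on $X$ and $C_{+}(X)$ is the semiring of non-negative real-valued continuous functions on $X$. For $f\in C(X)$, $Z(f)=\{x\in X: f(x)=0\}$. Let $\mathcal{N}(X)$ be the set of non-units of $C(X)$ (functions with $Z(f)\neq\emptyset$) and $\mathcal{N}'(X)=\mathcal{N}(X)\cap C_{+}(X)$, the set of non-units of $C_{+}(X)$. The zero-set intersection graph $\Gamma(C(X))$ has vertex set $\mathcal{N}(X)$, and $\Gamma(C_{+}(X))$ has vertex set $\mathcal{N}'(X)$; in each, distinct vertices $f,g$ are adjacent iff $Z(f)\cap Z(g)\neq\emptyset$. A clique is a nonempty set of vertices any two distinct members of which are adjacent; a maximal clique is a clique maximal with respect to inclusion. *)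

theory Defs
  imports "HOL-Analysis.Analysis" "HOL-Algebra.Ring" "HOL-Library.Ramsey"
begin

definition tychonoff_space :: "'a topology \<Rightarrow> bool" where
  "tychonoff_space X \<longleftrightarrow> completely_regular_space X \<and> Hausdorff_space X"

text \<open>
  An element of \<open>C(X)\<close> is a function on \<open>topspace X\<close>. It is represented by its extensional
  HOL function, so that two elements are equal iff they agree on \<open>topspace X\<close>; otherwise
  one continuous function would give rise to many distinct vertices.
\<close>

definition cont_funs :: "'a topology \<Rightarrow> ('a \<Rightarrow> real) set" where
  "cont_funs X = {f \<in> extensional (topspace X). continuous_map X euclideanreal f}"

definition nonneg_cont_funs :: "'a topology \<Rightarrow> ('a \<Rightarrow> real) set" where
  "nonneg_cont_funs X = {f \<in> cont_funs X. \<forall>x\<in>topspace X. 0 \<le> f x}"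

definition cont_ring :: "'a topology \<Rightarrow> ('a \<Rightarrow> real) ring" where
  "cont_ring X = \<lparr>carrier = cont_funs X,
     mult = (\<lambda>f g. \<lambda>x\<in>topspace X. f x * g x), one = (\<lambda>x\<in>topspace X. 1),
     zero = (\<lambda>x\<in>topspace X. 0), add = (\<lambda>f g. \<lambda>x\<in>topspace X. f x + g x)\<rparr>"

definition nonneg_cont_semiring :: "'a topology \<Rightarrow> ('a \<Rightarrow> real) ring" where
  "nonneg_cont_semiring X = (cont_ring X)\<lparr>carrier := nonneg_cont_funs X\<rparr>"

definition zero_set :: "'a topology \<Rightarrow> ('a \<Rightarrow> real) \<Rightarrow> 'a set" where
  "zero_set X f = {x \<in> topspace X. f x = 0}"

definition nonunits :: "'a topology \<Rightarrow> ('a \<Rightarrow> real) set" where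
  "nonunits X = carrier (cont_ring X) - Units (cont_ring X)"

definition nonneg_nonunits :: "'a topology \<Rightarrow> ('a \<Rightarrow> real) set" where
  "nonneg_nonunits X = nonunits X \<inter> nonneg_cont_funs X"

text \<open>A simple graph is given as the pair of its vertex set and its set of two-element edges.\<close>

type_synonym 'v simple_graph = "'v set \<times> 'v set set"

definition zero_set_graph_on ::
  "'a topology \<Rightarrow> ('a \<Rightarrow> real) set \<Rightarrow> ('a \<Rightarrow> real) simple_graph" where
  "zero_set_graph_on X V =
     (V, {{f, g} | f g. f \<in> V \<and> g \<in> V \<and> f \<noteq> g \<and> zero_set X f \<inter> zero_set X g \<noteq> {}})"

definition zero_set_graph :: "'a topology \<Rightarrow> ('a \<Rightarrow> real) simple_graph" where
  "zero_set_graph X = zero_set_graph_on X (nonunits X)"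

definition nonneg_zero_set_graph :: "'a topology \<Rightarrow> ('a \<Rightarrow> real) simple_graph" where
  "nonneg_zero_set_graph X = zero_set_graph_on X (nonneg_nonunits X)"

definition graph_clique :: "'v simple_graph \<Rightarrow> 'v set \<Rightarrow> bool" where
  "graph_clique G K \<longleftrightarrow> K \<noteq> {} \<and> K \<subseteq> fst G \<and> clique K (snd G)"

definition maximal_clique :: "'v simple_graph \<Rightarrow> 'v set \<Rightarrow> bool" where
  "maximal_clique G K \<longleftrightarrow>
     graph_clique G K \<and> (\<forall>L. graph_clique G L \<and> K \<subseteq> L \<longrightarrow> L = K)"

lemma cont_funs_restrict:
  "restrict f (topspace X) \<in> cont_funs X \<longleftrightarrow> continuous_map X euclideanreal f"
proof -
  have "continuous_map X euclideanreal (restrict f (topspace X)) \<longleftrightarrow>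
      continuous_map X euclideanreal f"
    by (auto elim: continuous_map_eq)
  then show ?thesis
    by (simp add: cont_funs_def)
qed

lemma cont_funs_closed:
  assumes "f \<in> cont_funs X" "g \<in> cont_funs X"
  shows "(\<lambda>x\<in>topspace X. f x + g x) \<in> cont_funs X"
    and "(\<lambda>x\<in>topspace X. f x * g x) \<in> cont_funs X"
    and "(\<lambda>x\<in>topspace X. - f x) \<in> cont_funs X"
proof -
  have "continuous_map X euclideanreal f" "continuous_map X euclideanreal g"
    using assms by (simp_all add: cont_funs_def)
  then show "(\<lambda>x\<in>topspace X. f x + g x) \<in> cont_funs X"
    and "(\<lambda>x\<in>topspace X. f x * g x) \<in> cont_funs X"
    and "(\<lambda>x\<in>topspace X. - f x) \<in> cont_funs X"
    by (simp_all only: cont_funs_restrict continuous_map_add continuous_map_real_mult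
        continuous_map_minus)
qed

lemma cont_funs_const: "(\<lambda>x\<in>topspace X. c) \<in> cont_funs X"
  by (simp add: cont_funs_restrict)

lemma cont_funs_undefined:
  "f \<in> cont_funs X \<Longrightarrow> x \<notin> topspace X \<Longrightarrow> f x = undefined"
  by (simp add: cont_funs_def extensional_def)

lemma cring_cont_ring: "cring (cont_ring X)"
proof (intro cringI abelian_groupI comm_monoidI)
  fix f assume f: "f \<in> carrier (cont_ring X)"
  then show "\<exists>g\<in>carrier (cont_ring X). g \<oplus>\<^bsub>cont_ring X\<^esub> f = \<zero>\<^bsub>cont_ring X\<^esub>"
    by (intro bexI[of _ "\<lambda>x\<in>topspace X. - f x"])
      (simp_all add: cont_ring_def cont_funs_closed fun_eq_iff)
qed (simp_all add: cont_ring_def cont_funs_closed cont_funs_const fun_eq_iff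
      cont_funs_undefined algebra_simps)

lemma semiring_nonneg_cont_semiring: "semiring (nonneg_cont_semiring X)"
  by unfold_locales
    (simp_all add: nonneg_cont_semiring_def nonneg_cont_funs_def cont_ring_def cont_funs_closed
      cont_funs_const fun_eq_iff algebra_simps,
     (metis cont_funs_undefined)+)

lemma restrict_eq_one_iff:
  "(\<lambda>x\<in>A. h x) = (\<lambda>x\<in>A. 1) \<longleftrightarrow> (\<forall>x\<in>A. h x = (1::real))"
  by (auto simp: fun_eq_iff)

lemma Units_cont_ring:
  "f \<in> Units (cont_ring X) \<longleftrightarrow>
     f \<in> cont_funs X \<and> (\<exists>g\<in>cont_funs X. \<forall>x\<in>topspace X. g x * f x = 1)"
  by (simp add: Units_def cont_ring_def restrict_eq_one_iff mult.commute)

lemma Units_nonneg_cont_semiring: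
  "f \<in> Units (nonneg_cont_semiring X) \<longleftrightarrow>
     f \<in> nonneg_cont_funs X \<and> (\<exists>g\<in>nonneg_cont_funs X. \<forall>x\<in>topspace X. g x * f x = 1)"
  by (simp add: Units_def nonneg_cont_semiring_def cont_ring_def restrict_eq_one_iff mult.commute)

lemma nonunits_eq: "nonunits X = {f \<in> cont_funs X. zero_set X f \<noteq> {}}"
proof -
  have "f \<in> Units (cont_ring X) \<longleftrightarrow> zero_set X f = {}" if f: "f \<in> cont_funs X" for f
  proof
    assume "f \<in> Units (cont_ring X)"
    then show "zero_set X f = {}"
      by (force simp: Units_cont_ring zero_set_def)
  next
    assume "zero_set X f = {}"
    then have nz: "f x \<noteq> 0" if "x \<in> topspace X" for x
      using that by (auto simp: zero_set_def)
    let ?g = "\<lambda>x\<in>topspace X. inverse (f x)"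
    have "continuous_map X euclideanreal f"
      using f by (simp add: cont_funs_def)
    then have "?g \<in> cont_funs X"
      unfolding cont_funs_restrict using nz by (rule continuous_map_real_inverse)
    moreover have "\<forall>x\<in>topspace X. ?g x * f x = 1"
      using nz by simp
    ultimately show "f \<in> Units (cont_ring X)"
      using f unfolding Units_cont_ring by blast
  qed
  then show ?thesis
    by (auto simp: nonunits_def cont_ring_def)
qed

lemma nonneg_nonunits_eq:
  "nonneg_nonunits X = carrier (nonneg_cont_semiring X) - Units (nonneg_cont_semiring X)"
proof -
  have sub: "nonneg_cont_funs X \<subseteq> cont_funs X"
    by (auto simp: nonneg_cont_funs_def)
  have "f \<in> Units (nonneg_cont_semiring X) \<longleftrightarrow> f \<in> Units (cont_ring X)"
    if f: "f \<in> nonneg_cont_funs X" for f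
  proof
    assume "f \<in> Units (nonneg_cont_semiring X)"
    then show "f \<in> Units (cont_ring X)"
      using sub unfolding Units_cont_ring Units_nonneg_cont_semiring by blast
  next
    assume "f \<in> Units (cont_ring X)"
    then obtain g where g: "g \<in> cont_funs X" and one: "\<forall>x\<in>topspace X. g x * f x = 1"
      unfolding Units_cont_ring by blast
    have "0 \<le> g x" if x: "x \<in> topspace X" for x
    proof (rule ccontr)
      assume "\<not> 0 \<le> g x"
      moreover have "0 \<le> f x"
        using f x by (simp add: nonneg_cont_funs_def)
      ultimately have "g x * f x \<le> 0"
        by (simp add: mult_nonpos_nonneg)
      with one x show False
        by simp
    qed
    with g have "g \<in> nonneg_cont_funs X"
      by (simp add: nonneg_cont_funs_def)
    with f one show "f \<in> Units (nonneg_cont_semiring X)"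
      unfolding Units_nonneg_cont_semiring by blast
  qed
  moreover have "carrier (nonneg_cont_semiring X) = nonneg_cont_funs X"
    "carrier (cont_ring X) = cont_funs X"
    by (simp_all add: nonneg_cont_semiring_def cont_ring_def)
  ultimately show ?thesis
    using sub unfolding nonneg_nonunits_def nonunits_def by blast
qed

end

theory Submission
  imports Defs
begin

text \<open>
  Passing from \<open>f\<close> to \<open>\<bar>f\<bar>\<close> does not change the zero set, so adjacency cannot distinguish
  \<open>f\<close> from \<open>\<bar>f\<bar>\<close>. The maximal clique \<open>M\<close> is therefore the preimage of \<open>K\<close> under
  \<open>f \<mapsto> \<bar>f\<bar>\<close>.
\<close>

text \<open>A non-unit has a nonempty zero set, so it meets itself and the pairs with
  \<open>f = g\<close> can be included. This matters because distinct functions such as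
  \<open>f\<close> and \<open>-f\<close> can have the same absolute value.\<close>

lemma graph_clique_zero_set_graph_on:
  assumes "V \<subseteq> nonunits X"
  shows "graph_clique (zero_set_graph_on X V) K \<longleftrightarrow>
    K \<noteq> {} \<and> K \<subseteq> V \<and> (\<forall>f\<in>K. \<forall>g\<in>K. zero_set X f \<inter> zero_set X g \<noteq> {})"
    (is "_ \<longleftrightarrow> ?rhs")
proof
  assume K: "graph_clique (zero_set_graph_on X V) K"
  then have "K \<noteq> {}" "K \<subseteq> V"
    by (simp_all add: graph_clique_def zero_set_graph_on_def)
  moreover have "zero_set X f \<inter> zero_set X g \<noteq> {}" if "f \<in> K" "g \<in> K" for f g
  proof (cases "f = g")
    case True
    then show ?thesis
      using that \<open>K \<subseteq> V\<close> assms by (auto simp: nonunits_eq)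
  next
    case False
    then have "{f, g} \<in> snd (zero_set_graph_on X V)"
      using K that by (simp add: graph_clique_def clique_def)
    then show ?thesis
      by (auto simp: zero_set_graph_on_def doubleton_eq_iff)
  qed
  ultimately show ?rhs
    by blast
next
  assume ?rhs
  then have "{f, g} \<in> snd (zero_set_graph_on X V)" if "f \<in> K" "g \<in> K" "f \<noteq> g" for f g
    using that unfolding zero_set_graph_on_def snd_conv by blast
  with \<open>?rhs\<close> show "graph_clique (zero_set_graph_on X V) K"
    by (simp add: graph_clique_def clique_def zero_set_graph_on_def)
qed

lemmas graph_clique_zero_set_graph =
  graph_clique_zero_set_graph_on[OF order_refl, folded zero_set_graph_def]

lemma graph_clique_nonneg_zero_set_graph:
  "graph_clique (nonneg_zero_set_graph X) K \<longleftrightarrow>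
    K \<noteq> {} \<and> K \<subseteq> nonneg_nonunits X \<and> (\<forall>f\<in>K. \<forall>g\<in>K. zero_set X f \<inter> zero_set X g \<noteq> {})"
  unfolding nonneg_zero_set_graph_def
  by (rule graph_clique_zero_set_graph_on) (simp add: nonneg_nonunits_def)

text \<open>The restriction keeps the result extensional, as membership in
  \<open>cont_funs X\<close> demands: off the space, \<bar>\<open>undefined\<close>\<bar> need not
  be \<open>undefined\<close>.\<close>

definition abs_fun :: "'a topology \<Rightarrow> ('a \<Rightarrow> real) \<Rightarrow> 'a \<Rightarrow> real" where
  "abs_fun X f = (\<lambda>x\<in>topspace X. \<bar>f x\<bar>)"

lemma zero_set_abs_fun [simp]: "zero_set X (abs_fun X f) = zero_set X f"
  by (auto simp: zero_set_def abs_fun_def)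

lemma abs_fun_nonneg_nonunits:
  assumes "f \<in> nonunits X"
  shows "abs_fun X f \<in> nonneg_nonunits X"
proof -
  have "continuous_map X euclideanreal f"
    using assms by (simp add: nonunits_eq cont_funs_def)
  then have "abs_fun X f \<in> cont_funs X"
    unfolding abs_fun_def cont_funs_restrict by (rule continuous_map_real_abs)
  then show ?thesis
    using assms
    by (simp add: nonneg_nonunits_def nonunits_eq nonneg_cont_funs_def) (simp add: abs_fun_def)
qed

lemma abs_fun_nonneg: "f \<in> nonneg_cont_funs X \<Longrightarrow> abs_fun X f = f"
  by (auto simp: abs_fun_def nonneg_cont_funs_def cont_funs_undefined fun_eq_iff)

theorem theorem3p6:
  fixes X :: "'a topology" and K :: "('a \<Rightarrow> real) set"
  assumes "tychonoff_space X"
    and "maximal_clique (nonneg_zero_set_graph X) K"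
  shows "\<exists>M. maximal_clique (zero_set_graph X) M \<and> K = M \<inter> nonneg_cont_funs X"
proof -
  define M where "M = {f \<in> nonunits X. abs_fun X f \<in> K}"
  have K: "K \<noteq> {}" "K \<subseteq> nonneg_nonunits X"
    and K_meet: "\<And>f g. f \<in> K \<Longrightarrow> g \<in> K \<Longrightarrow> zero_set X f \<inter> zero_set X g \<noteq> {}"
    and K_max: "\<And>L. graph_clique (nonneg_zero_set_graph X) L \<Longrightarrow> K \<subseteq> L \<Longrightarrow> L = K"
    using assms(2) unfolding maximal_clique_def graph_clique_nonneg_zero_set_graph by blast+
  \<comment> \<open>On non-negative functions \<open>abs_fun X\<close> is the identity, so there the
    condition defining \<open>M\<close> reduces to membership in \<open>K\<close>.\<close>
  have K_eq: "K = M \<inter> nonneg_cont_funs X"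
    using K(2) abs_fun_nonneg by (fastforce simp: M_def nonneg_nonunits_def)
  have "zero_set X f \<inter> zero_set X g \<noteq> {}" if "f \<in> M" "g \<in> M" for f g
    using K_meet[of "abs_fun X f" "abs_fun X g"] that by (simp add: M_def)
  moreover have "M \<noteq> {}" "M \<subseteq> nonunits X"
    using K(1) K_eq unfolding M_def by blast+
  ultimately have "graph_clique (zero_set_graph X) M"
    unfolding graph_clique_zero_set_graph by blast
  moreover have "L = M" if L: "graph_clique (zero_set_graph X) L" "M \<subseteq> L" for L
  proof -
    have "f \<in> M" if f: "f \<in> L" for f
    proof -
      have f_nonunit: "f \<in> nonunits X"
        and f_meet: "\<And>g. g \<in> L \<Longrightarrow> zero_set X f \<inter> zero_set X g \<noteq> {}"
        using L(1) f unfolding graph_clique_zero_set_graph by blast+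
      \<comment> \<open>Since \<open>f\<close> lies in the clique \<open>L\<close>, this inclusion
        makes the zero set of \<open>f\<close> meet that of every member of
        \<open>K\<close>.\<close>
      have "K \<subseteq> L"
        using K_eq L(2) by blast
      \<comment> \<open>\<open>abs_fun X f\<close> has the zero set of \<open>f\<close>, so it
        inherits these intersections and can be added to \<open>K\<close>;
        \<open>f_meet[OF f]\<close> covers its pair with itself. Maximality of \<open>K\<close> then
        forces it into \<open>K\<close>.\<close>
      then have "graph_clique (nonneg_zero_set_graph X) (insert (abs_fun X f) K)"
        using K K_meet abs_fun_nonneg_nonunits[OF f_nonunit] f f_meet[OF f]
        unfolding graph_clique_nonneg_zero_set_graph
        by (simp add: f_meet subsetD Int_commute[of _ "zero_set X f"])
      then have "abs_fun X f \<in> K"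
        using K_max by blast
      with f_nonunit show ?thesis
        by (simp add: M_def)
    qed
    with L(2) show ?thesis
      by blast
  qed
  ultimately have "maximal_clique (zero_set_graph X) M"
    unfolding maximal_clique_def by blast
  with K_eq show ?thesis
    by blast
qed

end
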